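(* Let $g:\mathbb{N}\to\mathbb{N}$ be any function. Then for every finite coloring $\mathbb{N}=C_1\cup\ldots\cup C_r$ and for every non-trivial multiplicatively closed subset $X\subseteq\mathbb{N}$, there exist an increasing sequence $(a_n)_{n\in\mathbb{N}}$ of natural numbers and an index $i\in\{1,\ldots,r\}$ such that for all $k\ge 1$ and all indices $n_1,n_2,\ldots,n_k,s,t\in\mathbb{N}$ with $n_1,\ldots,n_k<s<t$ (the $n_j$ being in arbitrary order and possibly repeated) and $k\le g(s-1)$, the element $$a_t^{\,a_s^{\,a_{n_1}^{\,a_{n_2}^{\,\cdot^{\cdot^{\cdot^{a_{n_k}}}}}}}}$$ belongs to $X\cap C_i$.
   Context: $\mathbb{N}$ denotes the set of positive integers. A finite coloring is a finite partition. A multiplicatively closed set $X\subseteq\mathbb{N}$ is non-trivial if $X\neq\emptyset$ and $X\ne\{1\}$. "Increasing" means strictly increasing. Towers written without parentheses are evaluated from the top, i.e. $a^{b^c}=a^{(b^c)}$, etc. *)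

theory Defs
  imports Main "HOL-Library.FuncSet" "HOL-Library.Disjoint_Sets"
begin

text \<open>The positive integers are the subset \<^term>\<open>{1..}\<close> of the type \<^typ>\<open>nat\<close>. Sequences
  and functions on the positive integers are functions on \<^typ>\<open>nat\<close> whose value at 0 plays no role.\<close>

text \<open>Colour classes may be empty.\<close>

definition finite_coloring :: "nat \<Rightarrow> (nat \<Rightarrow> nat set) \<Rightarrow> bool" where
  "finite_coloring r C \<longleftrightarrow>
     (\<Union>i\<in>{1..r}. C i) = {1..} \<and> disjoint_family_on C {1..r}"

definition mult_closed :: "nat set \<Rightarrow> bool" where
  "mult_closed X \<longleftrightarrow> (\<forall>x\<in>X. \<forall>y\<in>X. x * y \<in> X)"

text \<open>The empty tower is 1, so that a tower of height one is its only entry.\<close>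

fun tower :: "nat list \<Rightarrow> nat" where
  "tower [] = 1"
| "tower (x # xs) = x ^ tower xs"

end

theory Submission
  imports Defs
begin

text \<open>
  Fix \<open>x \<in> X\<close> with \<open>x \<ge> 2\<close> and look for a sequence of the form \<open>a\<^sub>n = x ^ b\<^sub>n\<close>. All positive powers
  of \<open>x\<close> lie in \<open>X\<close>, and if \<open>M\<close> is the value of the tower over \<open>a\<^sub>n\<^sub>1, \<dots>, a\<^sub>n\<^sub>k\<close>, then
  \<open>a\<^sub>t ^ (a\<^sub>s ^ M) = x ^ (b\<^sub>t * x ^ (b\<^sub>s * M))\<close>. Colouring \<open>e\<close> by the colour of \<open>x ^ e\<close>, it is enough
  to find a colour class \<open>G\<close> and an increasing sequence \<open>b\<close> such that \<open>b\<^sub>t * x ^ (b\<^sub>s * M) \<in> G\<close> for all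
  \<open>s < t\<close> and all \<open>M \<le> N\<close>, where the bound \<open>N\<close> may depend on the terms before \<open>b\<^sub>s\<close>; it absorbs the
  finitely many towers that the function \<open>g\<close> permits.

  Such a sequence is built greedily inside shrinking sets which remain piecewise syndetic in the
  semigroup of positive integers under multiplication. This notion of largeness is partition regular,
  so some colour class is large. The heart of the proof is \<open>mult_PS_recurrence\<close>: a large set \<open>G\<close>
  contains arbitrarily big \<open>y\<close> for which the set of all \<open>v\<close> with \<open>v * x ^ (M * y) \<in> G\<close> for every
  \<open>M \<le> N\<close> is again large. Taking \<open>y\<close> as the next term and passing to this smaller set keeps the
  construction going.

  The recurrence property needs no more than van der Waerden's theorem. A long progression of exponents
  with difference \<open>q\<close> contains, for every small \<open>j\<close>, a progression of \<open>N + 1\<close> terms with difference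
  \<open>j * q\<close>. Multiplicative largeness of \<open>G\<close> allows all occurring differences \<open>q\<close> to be chosen such
  that one of these multiples \<open>j * q\<close> belongs to \<open>G\<close>.
\<close>

section \<open>Van der Waerden's theorem\<close>

text \<open>The bound on the difference \<open>d\<close> serves the induction on \<open>k\<close>, which prolongs progressions by one
  term: for \<open>k = 0\<close>, only this bound keeps the additional term in a bounded range.\<close>

definition vdW :: "nat \<Rightarrow> bool" where
  "vdW k \<longleftrightarrow> (\<forall>r. \<exists>V. \<forall>c :: nat \<Rightarrow> nat. (\<forall>i\<le>V. c i < r) \<longrightarrow>
     (\<exists>a d. 0 < d \<and> d \<le> V \<and> a + k * d \<le> V \<and> (\<forall>M\<le>k. c (a + M * d) = c a)))"

lemma vdW_finite_colors:
  fixes S :: "'c set"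
  assumes "vdW k" "finite S"
  shows "\<exists>V. \<forall>c. (\<forall>i\<le>V. c i \<in> S) \<longrightarrow>
    (\<exists>a d. 0 < d \<and> d \<le> V \<and> a + k * d \<le> V \<and> (\<forall>M\<le>k. c (a + M * d) = c a))"
proof -
  from \<open>finite S\<close> obtain h :: "'c \<Rightarrow> nat" and r where h: "h ` S = {i. i < r}" "inj_on h S"
    by (blast dest: finite_imp_inj_to_nat_seg)
  from \<open>vdW k\<close> obtain V where V: "\<forall>c :: nat \<Rightarrow> nat. (\<forall>i\<le>V. c i < r) \<longrightarrow>
     (\<exists>a d. 0 < d \<and> d \<le> V \<and> a + k * d \<le> V \<and> (\<forall>M\<le>k. c (a + M * d) = c a))"
    unfolding vdW_def by (elim allE[of _ r] exE)
  show ?thesis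
  proof (rule exI[of _ V], intro allI impI)
    fix c assume c: "\<forall>i\<le>V. c i \<in> S"
    have "\<forall>i\<le>V. (h \<circ> c) i < r" using c h(1) by auto
    with V[THEN spec, of "h \<circ> c"] obtain a d where ad: "0 < d" "d \<le> V" "a + k * d \<le> V"
      and eq: "\<And>M. M \<le> k \<Longrightarrow> h (c (a + M * d)) = h (c a)" by auto
    have "c (a + M * d) = c a" if "M \<le> k" for M
    proof -
      have "a + M * d \<le> V" using that ad(3) mult_le_mono1[OF that, of d] by linarith
      then show ?thesis
        using c ad(3) eq[OF that] inj_onD[OF h(2), of "c (a + M * d)" "c a"] by simp
    qed
    with ad show "\<exists>a d. 0 < d \<and> d \<le> V \<and> a + k * d \<le> V \<and> (\<forall>M\<le>k. c (a + M * d) = c a)"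
      by blast
  qed
qed

text \<open>The progressions of colour focusing, which differ in colour but share the next term \<open>p\<close>. If \<open>p\<close>
  itself has one of their colours, the corresponding progression gets longer.\<close>

definition focused :: "nat \<Rightarrow> (nat \<Rightarrow> nat) \<Rightarrow> nat \<Rightarrow> nat set \<Rightarrow> bool" where
  "focused k c p \<Gamma> \<longleftrightarrow>
     (\<forall>\<gamma>\<in>\<Gamma>. \<exists>a d. 0 < d \<and> a + Suc k * d = p \<and> (\<forall>M\<le>k. c (a + M * d) = \<gamma>))"

definition has_AP :: "nat \<Rightarrow> (nat \<Rightarrow> nat) \<Rightarrow> nat \<Rightarrow> bool" where
  "has_AP k c V \<longleftrightarrow> (\<exists>a d. 0 < d \<and> a + k * d \<le> V \<and> (\<forall>M\<le>k. c (a + M * d) = c a))"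

lemma has_AP_shift:
  assumes "has_AP k (\<lambda>i. c (q + i)) V" "q + V \<le> V'"
  shows "has_AP k c V'"
proof -
  from assms(1) obtain a d where "0 < d" "a + k * d \<le> V"
    "\<forall>M\<le>k. c (q + (a + M * d)) = c (q + a)"
    unfolding has_AP_def by auto
  then show ?thesis
    unfolding has_AP_def using assms(2)
    by (intro exI[of _ "q + a"] exI[of _ d]) (auto simp: add.assoc)
qed

lemma focused_imp_has_AP:
  assumes "focused k c p \<Gamma>" "c p \<in> \<Gamma>" "p \<le> V"
  shows "has_AP (Suc k) c V"
proof -
  from assms(1,2) obtain a d where ad: "0 < d" "a + Suc k * d = p"
    and eq: "\<And>M. M \<le> k \<Longrightarrow> c (a + M * d) = c p"
    unfolding focused_def by blast
  have "c (a + M * d) = c a" if "M \<le> Suc k" for M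
    using that eq[of M] eq[of 0] ad(2) by (cases "M = Suc k") auto
  then show ?thesis
    unfolding has_AP_def using ad assms(3) by (intro exI[of _ a] exI[of _ d]) auto
qed

text \<open>Colour focusing. Cut the integers into blocks long enough for \<open>s\<close> focused colours. As the
  blocks have finitely many colour patterns, progressions of length \<open>k + 1\<close> exist among them: there
  are \<open>k + 1\<close> equally spaced blocks with the same pattern. Running each of the \<open>s\<close>
  progressions diagonally through these blocks moves their common focus to the block that comes
  next. The copies of the old focus form another progression towards the new focus, and its colour
  is new unless a progression of \<open>k + 2\<close> terms has already appeared.\<close>

lemma color_focusing:
  assumes "vdW k"
  shows "\<exists>V. \<forall>c. (\<forall>i\<le>V. c i < r) \<longrightarrow> has_AP (Suc k) c V \<or>
     (\<exists>p\<le>V. \<exists>\<Gamma>. \<Gamma> \<subseteq> {..<r} \<and> card \<Gamma> = s \<and> focused k c p \<Gamma>)"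
proof (induction s)
  case 0
  show ?case
    by (rule exI[of _ 0]) (auto simp: focused_def intro!: exI[of _ "{}"])
next
  case (Suc s)
  then obtain V where V: "\<forall>c. (\<forall>i\<le>V. c i < r) \<longrightarrow> has_AP (Suc k) c V \<or>
     (\<exists>p\<le>V. \<exists>\<Gamma>. \<Gamma> \<subseteq> {..<r} \<and> card \<Gamma> = s \<and> focused k c p \<Gamma>)" ..
  define B where "B = Suc V"
  have "finite {xs. set xs \<subseteq> {..<r} \<and> length xs = B}"
    by (rule finite_lists_length_eq) simp
  from vdW_finite_colors[OF assms this] obtain V' where
    V': "\<forall>c. (\<forall>b\<le>V'. c b \<in> {xs. set xs \<subseteq> {..<r} \<and> length xs = B}) \<longrightarrow>
      (\<exists>a d. 0 < d \<and> d \<le> V' \<and> a + k * d \<le> V' \<and> (\<forall>M\<le>k. c (a + M * d) = c a))" ..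
  \<comment> \<open>The identical blocks have numbers up to \<open>V'\<close> and distance up to \<open>V'\<close>, so the next block in
    line has number at most \<open>2 * V'\<close>.\<close>
  define U where "U = 2 * V' * B + V"
  show ?case
  proof (rule exI[of _ U], intro allI impI)
    fix c :: "nat \<Rightarrow> nat"
    assume c: "\<forall>i\<le>U. c i < r"
    define pat where "pat b = map (\<lambda>i. c (b * B + i)) [0..<B]" for b
    have inU: "b * B + i \<le> U" if "b \<le> 2 * V'" "i \<le> V" for b i
      unfolding U_def using that mult_le_mono1[OF that(1), of B] by linarith
    have "\<forall>b\<le>V'. pat b \<in> {xs. set xs \<subseteq> {..<r} \<and> length xs = B}"
      using inU c by (auto simp: pat_def B_def less_Suc_eq_le simp del: upt_Suc)
    with V'[THEN spec, of pat] obtain b D where D: "0 < D" "D \<le> V'" "b + k * D \<le> V'"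
      and pat: "\<And>M. M \<le> k \<Longrightarrow> pat (b + M * D) = pat b" by blast
    have same: "c ((b + M * D) * B + i) = c (b * B + i)" if "M \<le> k" "i \<le> V" for M i
    proof -
      have "pat (b + M * D) ! i = pat b ! i" using pat[OF that(1)] by simp
      then show ?thesis using that(2) by (simp add: pat_def B_def del: upt_Suc)
    qed
    have b: "b \<le> V'" using D(3) by linarith
    have "\<forall>i\<le>V. c (b * B + i) < r" using inU[of b] b c by auto
    from V[THEN spec, THEN mp, OF this]
    show "has_AP (Suc k) c U \<or>
        (\<exists>p\<le>U. \<exists>\<Gamma>. \<Gamma> \<subseteq> {..<r} \<and> card \<Gamma> = Suc s \<and> focused k c p \<Gamma>)"
    proof
      assume "has_AP (Suc k) (\<lambda>i. c (b * B + i)) V"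
      then have "has_AP (Suc k) c U"
        by (rule has_AP_shift) (use inU[of b V] b in auto)
      then show ?thesis ..
    next
      assume "\<exists>p\<le>V. \<exists>\<Gamma>. \<Gamma> \<subseteq> {..<r} \<and> card \<Gamma> = s \<and> focused k (\<lambda>i. c (b * B + i)) p \<Gamma>"
      then obtain p \<Gamma> where p: "p \<le> V" and \<Gamma>: "\<Gamma> \<subseteq> {..<r}" "card \<Gamma> = s"
        and foc: "focused k (\<lambda>i. c (b * B + i)) p \<Gamma>" by blast
      show ?thesis
      proof (cases "c (b * B + p) \<in> \<Gamma>")
        case True
        have "has_AP (Suc k) (\<lambda>i. c (b * B + i)) V"
          by (rule focused_imp_has_AP[OF foc]) (use True p in auto)
        then have "has_AP (Suc k) c U"
          by (rule has_AP_shift) (use inU[of b V] b in auto)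
        then show ?thesis ..
      next
        case False
        define p' where "p' = (b + Suc k * D) * B + p"
        have "b + Suc k * D \<le> 2 * V'" using D by simp
        then have p': "p' \<le> U" unfolding p'_def by (rule inU) (rule p)
        have "focused k c p' (insert (c (b * B + p)) \<Gamma>)"
          unfolding focused_def
        proof
          fix \<gamma> assume "\<gamma> \<in> insert (c (b * B + p)) \<Gamma>"
          then consider "\<gamma> = c (b * B + p)" | "\<gamma> \<in> \<Gamma>" by blast
          then show "\<exists>a d. 0 < d \<and> a + Suc k * d = p' \<and> (\<forall>M\<le>k. c (a + M * d) = \<gamma>)"
          proof cases
            case 1
            have "c ((b * B + p) + M * (D * B)) = \<gamma>" if "M \<le> k" for M
              using same[OF that p] 1 by (simp add: algebra_simps)
            moreover have "(b * B + p) + Suc k * (D * B) = p'"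
              by (simp add: p'_def algebra_simps)
            moreover have "0 < D * B" using D(1) by (simp add: B_def)
            ultimately show ?thesis by blast
          next
            case 2
            then obtain a d where ad: "0 < d" "a + Suc k * d = p"
              and eq: "\<And>M. M \<le> k \<Longrightarrow> c (b * B + (a + M * d)) = \<gamma>"
              using foc unfolding focused_def by blast
            have "c ((b * B + a) + M * (d + D * B)) = \<gamma>" if "M \<le> k" for M
            proof -
              have "M * d \<le> Suc k * d" using that by (intro mult_le_mono1) simp
              then have "a + M * d \<le> V" using ad(2) p by linarith
              from same[OF that this] eq[OF that] show ?thesis by (simp add: algebra_simps)
            qed
            moreover have "(b * B + a) + Suc k * (d + D * B) = p'"
              using ad(2) by (simp add: p'_def algebra_simps)
            moreover have "0 < d + D * B" using ad(1) by simp
            ultimately show ?thesis by blast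
          qed
        qed
        moreover have "card (insert (c (b * B + p)) \<Gamma>) = Suc s"
          using False \<Gamma> finite_subset[OF \<Gamma>(1)] by simp
        moreover have "insert (c (b * B + p)) \<Gamma> \<subseteq> {..<r}"
          using \<Gamma>(1) inU[of b p] b p c by auto
        ultimately show ?thesis using p' by blast
      qed
    qed
  qed
qed

theorem van_der_Waerden: "vdW k"
proof (induction k)
  case 0
  show ?case unfolding vdW_def by (auto intro!: exI[of _ 1])
next
  case (Suc k)
  show ?case
    unfolding vdW_def
  proof
    fix r
    \<comment> \<open>More colours than there are cannot be focused.\<close>
    from color_focusing[OF Suc, of r "Suc r"] obtain V where
      V: "\<forall>c. (\<forall>i\<le>V. c i < r) \<longrightarrow> has_AP (Suc k) c V \<or>
        (\<exists>p\<le>V. \<exists>\<Gamma>. \<Gamma> \<subseteq> {..<r} \<and> card \<Gamma> = Suc r \<and> focused k c p \<Gamma>)" ..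
    have few: "card \<Gamma> \<noteq> Suc r" if "\<Gamma> \<subseteq> {..<r}" for \<Gamma>
      using card_mono[OF finite_lessThan that] by simp
    have "has_AP (Suc k) c V" if "\<forall>i\<le>V. c i < r" for c
      using V[THEN spec, THEN mp, OF that] few by blast
    moreover have "\<exists>a d. 0 < d \<and> d \<le> V \<and> a + Suc k * d \<le> V \<and> (\<forall>M\<le>Suc k. c (a + M * d) = c a)"
      if AP: "has_AP (Suc k) c V" for c
    proof -
      from AP obtain a d where ad: "0 < d" "a + Suc k * d \<le> V" "\<forall>M\<le>Suc k. c (a + M * d) = c a"
        unfolding has_AP_def by blast
      moreover from ad(2) have "d \<le> V" by simp
      ultimately show ?thesis by blast
    qed
    ultimately show "\<exists>V. \<forall>c :: nat \<Rightarrow> nat. (\<forall>i\<le>V. c i < r) \<longrightarrow> (\<exists>a d. 0 < d \<and> d \<le> V \<and>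
        a + Suc k * d \<le> V \<and> (\<forall>M\<le>Suc k. c (a + M * d) = c a))"
      by blast
  qed
qed

section \<open>Multiplicatively piecewise syndetic sets\<close>

text \<open>Piecewise syndetic sets in the semigroup of positive integers under multiplication: the union of
  the quotients \<open>{v. f * v \<in> G}\<close> over \<open>f \<in> F\<close> is thick, that is, it contains dilates of all
  finite sets.\<close>

definition mult_PS :: "nat set \<Rightarrow> bool" where
  "mult_PS G \<longleftrightarrow> (\<exists>F. finite F \<and> F \<subseteq> {1..} \<and>
     (\<forall>E. finite E \<longrightarrow> E \<subseteq> {1..} \<longrightarrow> (\<exists>n>0. \<forall>e\<in>E. \<exists>f\<in>F. f * n * e \<in> G)))"

lemma mult_PS_positives: "mult_PS {1..}"
  unfolding mult_PS_def by (rule exI[of _ "{1}"]) (auto intro!: exI[of _ 1])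

lemma not_mult_PS_empty: "\<not> mult_PS {}"
  unfolding mult_PS_def by (auto intro!: exI[of _ "{1}"])

text \<open>Let \<open>F\<close> witness the largeness of \<open>A \<union> B\<close>. If \<open>F\<close> is not a witness for \<open>B\<close>, then some finite
  set \<open>E\<close> has no dilate inside the quotients of \<open>B\<close> by \<open>F\<close>. Hence every dilate of \<open>E\<close> inside the
  quotients of the union has a point in a quotient of \<open>A\<close>, so that multiplying \<open>F\<close> by \<open>E\<close> gives a
  witness for \<open>A\<close>.\<close>

lemma mult_PS_Un:
  assumes "mult_PS (A \<union> B)"
  shows "mult_PS A \<or> mult_PS B"
proof (rule disjCI)
  assume nB: "\<not> mult_PS B"
  from assms obtain F where F: "finite F" "F \<subseteq> {1..}"
    and AB: "\<And>E. finite E \<Longrightarrow> E \<subseteq> {1..} \<Longrightarrow> \<exists>n>0. \<forall>e\<in>E. \<exists>f\<in>F. f * n * e \<in> A \<union> B"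
    unfolding mult_PS_def by blast
  have "\<not> (\<forall>E. finite E \<longrightarrow> E \<subseteq> {1..} \<longrightarrow> (\<exists>n>0. \<forall>e\<in>E. \<exists>f\<in>F. f * n * e \<in> B))"
    using nB[unfolded mult_PS_def not_ex, THEN spec, of F] F by simp
  then obtain E where E: "finite E" "E \<subseteq> {1..}"
    and noB: "\<And>n. n > 0 \<Longrightarrow> \<exists>e\<in>E. \<forall>f\<in>F. f * n * e \<notin> B"
    by (simp only: not_all not_ex not_imp de_Morgan_conj ball_simps bex_simps) blast
  define F' where "F' = (\<lambda>(f, e). f * e) ` (F \<times> E)"
  have "\<exists>n>0. \<forall>h\<in>H. \<exists>f\<in>F'. f * n * h \<in> A" if H: "finite H" "H \<subseteq> {1..}" for H
  proof -
    have "finite ((\<lambda>(e, h). e * h) ` (E \<times> H))" "(\<lambda>(e, h). e * h) ` (E \<times> H) \<subseteq> {1..}"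
      using E H by (auto simp: subset_iff Suc_le_eq)
    from AB[OF this] obtain n where n: "n > 0"
      and AB': "\<And>e h. e \<in> E \<Longrightarrow> h \<in> H \<Longrightarrow> \<exists>f\<in>F. f * n * (e * h) \<in> A \<union> B" by force
    have "\<exists>f\<in>F'. f * n * h \<in> A" if h: "h \<in> H" for h
    proof -
      have "n * h > 0" using n h H(2) by (auto simp: subset_iff Suc_le_eq)
      from noB[OF this] obtain e where e: "e \<in> E" "\<forall>f\<in>F. f * (n * h) * e \<notin> B" by blast
      with AB'[OF e(1) h] obtain f where f: "f \<in> F" "f * n * (e * h) \<in> A"
        by (auto simp: ac_simps)
      have "(f * e) * n * h \<in> A" using f(2) by (simp add: ac_simps)
      moreover have "f * e \<in> F'" using f(1) e(1) by (auto simp: F'_def)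
      ultimately show ?thesis by blast
    qed
    with n show ?thesis by blast
  qed
  moreover have "finite F'" "F' \<subseteq> {1..}"
    using F E by (auto simp: F'_def subset_iff Suc_le_eq)
  ultimately show "mult_PS A" unfolding mult_PS_def by blast
qed

lemma mult_PS_UN:
  assumes "finite I" "mult_PS (\<Union>i\<in>I. A i)"
  shows "\<exists>i\<in>I. mult_PS (A i)"
  using assms
proof (induction I rule: finite_induct)
  case empty
  then show ?case using not_mult_PS_empty by simp
next
  case (insert i I)
  then show ?case using mult_PS_Un[of "A i" "\<Union>i\<in>I. A i"] by auto
qed

section \<open>Recurrence along exponentials\<close>

definition returns :: "nat \<Rightarrow> nat \<Rightarrow> nat set \<Rightarrow> nat \<Rightarrow> nat set" where
  "returns x N G y = {v. \<forall>M\<le>N. v * x ^ (M * y) \<in> G}"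

text \<open>Let \<open>F\<close> witness that \<open>G\<close> is large and let \<open>V\<close> be a van der Waerden number for colourings by \<open>F\<close>
  and progressions of \<open>N * Max F + 1\<close> terms. The candidates for \<open>y\<close> are the elements \<open>f * q * d\<close> of
  \<open>G\<close> with \<open>f \<in> F\<close> and \<open>d \<le> V\<close>, where \<open>q\<close> is such that every \<open>d \<le> V\<close> admits a suitable \<open>f\<close>. Colour
  \<open>k \<le> V\<close> by some \<open>f'\<close> for which \<open>f'\<close> times a given multiple of \<open>x ^ (q * k)\<close> lies in \<open>G\<close>.
  A monochromatic progression with difference \<open>d\<close> then provides a return along the candidate
  \<open>f * q * d\<close>, as the indices \<open>f * M\<close> with \<open>M \<le> N\<close> stay within the progression. Thus the return sets of
  the finitely many candidates have a large union.\<close>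

lemma mult_PS_recurrence:
  assumes "mult_PS G" "x \<ge> 1"
  obtains y where "y \<in> G" "y > m" "mult_PS (returns x N G y)"
proof -
  from assms(1) obtain F where F: "finite F" "F \<subseteq> {1..}"
    and thick: "\<And>E. finite E \<Longrightarrow> E \<subseteq> {1..} \<Longrightarrow> \<exists>n>0. \<forall>e\<in>E. \<exists>f\<in>F. f * n * e \<in> G"
    unfolding mult_PS_def by blast
  define L where "L = N * Max F"
  from vdW_finite_colors[OF van_der_Waerden F(1)] obtain V where
    V: "\<forall>c. (\<forall>i\<le>V. c i \<in> F) \<longrightarrow>
      (\<exists>a d. 0 < d \<and> d \<le> V \<and> a + L * d \<le> V \<and> (\<forall>M\<le>L. c (a + M * d) = c a))" ..
  \<comment> \<open>The factor \<open>Suc m\<close> forces all candidates above \<open>m\<close>.\<close>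
  have "finite ((\<lambda>d. Suc m * d) ` {1..V})" "(\<lambda>d. Suc m * d) ` {1..V} \<subseteq> {1..}" by auto
  from thick[OF this] obtain n0 where n0: "n0 > 0"
    and n0G: "\<forall>d\<in>{1..V}. \<exists>f\<in>F. f * n0 * (Suc m * d) \<in> G" by blast
  define q where "q = n0 * Suc m"
  have qG: "\<exists>f\<in>F. f * q * d \<in> G" if "d \<in> {1..V}" for d
    using n0G that unfolding q_def by (metis mult.assoc)
  define Y where "Y = {y \<in> (\<lambda>(f, d). f * q * d) ` (F \<times> {1..V}). y \<in> G}"
  define F' where "F' = (\<lambda>(f, k). f * x ^ (q * k)) ` (F \<times> {..V})"
  have "finite Y" unfolding Y_def using F(1) by simp
  have "\<exists>n>0. \<forall>e\<in>E. \<exists>f\<in>F'. f * n * e \<in> (\<Union>y\<in>Y. returns x N G y)"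
    if E: "finite E" "E \<subseteq> {1..}" for E
  proof -
    have "finite ((\<lambda>(e, k). e * x ^ (q * k)) ` (E \<times> {..V}))"
         "(\<lambda>(e, k). e * x ^ (q * k)) ` (E \<times> {..V}) \<subseteq> {1..}"
      using E assms(2) by (auto simp: subset_iff Suc_le_eq)
    from thick[OF this] obtain n where n: "n > 0"
      and nG: "\<And>e k. e \<in> E \<Longrightarrow> k \<le> V \<Longrightarrow> \<exists>f\<in>F. f * n * (e * x ^ (q * k)) \<in> G" by force
    have "\<exists>f\<in>F'. f * n * e \<in> (\<Union>y\<in>Y. returns x N G y)" if e: "e \<in> E" for e
    proof -
      obtain c where c: "\<And>k. k \<le> V \<Longrightarrow> c k \<in> F \<and> c k * n * (e * x ^ (q * k)) \<in> G"
        using nG[OF e] by metis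
      with V[THEN spec, of c] obtain a d where d: "0 < d" "d \<le> V" "a + L * d \<le> V"
        and mono: "\<And>M. M \<le> L \<Longrightarrow> c (a + M * d) = c a" by blast
      from qG[of d] d obtain f where f: "f \<in> F" "f * q * d \<in> G" by auto
      have "c a * x ^ (q * a) * n * e * x ^ (M * (f * q * d)) \<in> G" if "M \<le> N" for M
      proof -
        have M: "M * f \<le> L"
          unfolding L_def using that f(1) F(1) by (intro mult_le_mono Max_ge)
        then have "M * f * d \<le> L * d" by simp
        then have "a + M * f * d \<le> V" using d(3) by linarith
        from c[OF this] mono[OF M] show ?thesis by (simp add: algebra_simps power_add)
      qed
      then have "c a * x ^ (q * a) * n * e \<in> returns x N G (f * q * d)"
        by (simp add: returns_def)
      moreover have "f * q * d \<in> Y" using f d by (auto simp: Y_def)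
      moreover have "c a * x ^ (q * a) \<in> F'" using c[of a] d(3) by (auto simp: F'_def)
      ultimately show ?thesis by blast
    qed
    with n show ?thesis by blast
  qed
  moreover have "finite F'" "F' \<subseteq> {1..}"
    using F assms(2) by (auto simp: F'_def subset_iff Suc_le_eq)
  ultimately have "mult_PS (\<Union>y\<in>Y. returns x N G y)" unfolding mult_PS_def by blast
  from mult_PS_UN[OF \<open>finite Y\<close> this] obtain y where y: "y \<in> Y" "mult_PS (returns x N G y)"
    by blast
  have "y > m"
  proof -
    from y(1) obtain f d where "f \<in> F" "d \<in> {1..V}" and yfd: "y = f * q * d"
      by (auto simp: Y_def)
    then have "1 \<le> f * d" using F(2) by (auto simp: Suc_le_eq)
    then have "1 * q \<le> (f * d) * q" by (rule mult_le_mono1)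
    then have "y \<ge> q" unfolding yfd by (simp add: ac_simps)
    moreover have "q \<ge> Suc m" using mult_le_mono1[of 1 n0 "Suc m"] n0 unfolding q_def by simp
    ultimately show ?thesis by linarith
  qed
  moreover have "y \<in> G" using y(1) by (simp add: Y_def)
  ultimately show ?thesis using that y(2) by blast
qed

text \<open>A state of the construction pairs the list of terms chosen so far with the large set from which
  all later terms are taken. Since \<open>v \<in> returns x N G y\<close> implies \<open>v \<in> G\<close> (take \<open>M = 0\<close>), these sets
  decrease, so later terms keep satisfying the earlier requirements.\<close>

lemma mult_PS_exponential_sequence:
  fixes N :: "nat list \<Rightarrow> nat"
  assumes "mult_PS G" "x \<ge> 1"
  shows "\<exists>b :: nat \<Rightarrow> nat. strict_mono b \<and>
    (\<forall>s t M. s < t \<longrightarrow> M \<le> N (map b [0..<s]) \<longrightarrow> b t * x ^ (M * b s) \<in> G)"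
proof -
  define step where "step = (\<lambda>(h, H) (h', H'). \<exists>y. h' = h @ [y] \<and> y \<in> H \<and>
     (\<forall>z\<in>set h. z < y) \<and> H' = returns x (N h) H y)"
  have "\<exists>f. (\<forall>n. (case f n of (h, H) \<Rightarrow> mult_PS H \<and> (n = 0 \<longrightarrow> h = [] \<and> H = G)) \<and>
    step (f n) (f (Suc n)))"
  proof (rule dependent_nat_choice)
    show "\<exists>p. case p of (h, H) \<Rightarrow> mult_PS H \<and> ((0::nat) = 0 \<longrightarrow> h = [] \<and> H = G)"
      using assms(1) by (intro exI[of _ "([], G)"]) simp
  next
    fix p :: "nat list \<times> nat set" and n :: nat
    assume p: "case p of (h, H) \<Rightarrow> mult_PS H \<and> (n = 0 \<longrightarrow> h = [] \<and> H = G)"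
    obtain h H where hH: "p = (h, H)" by force
    with p have "mult_PS H" by simp
    obtain y where y: "y \<in> H" "y > sum_list h" "mult_PS (returns x (N h) H y)"
      by (rule mult_PS_recurrence[OF \<open>mult_PS H\<close> assms(2)])
    have "\<forall>z\<in>set h. z < y" using y(2) by (blast intro: member_le_sum_list le_less_trans)
    with y show "\<exists>q. (case q of (h, H) \<Rightarrow> mult_PS H \<and> (Suc n = 0 \<longrightarrow> h = [] \<and> H = G)) \<and> step p q"
      by (intro exI[of _ "(h @ [y], returns x (N h) H y)"]) (auto simp: hH step_def)
  qed
  then obtain f where f0: "f 0 = ([], G)" and f: "\<And>n. step (f n) (f (Suc n))"
    by (metis (mono_tags, lifting) case_prodE)
  define H where "H n = snd (f n)" for n
  define b where "b n = last (fst (f (Suc n)))" for n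
  have hist_Suc: "fst (f (Suc n)) = fst (f n) @ [b n]"
    and bH: "b n \<in> H n"
    and bgt: "\<forall>z\<in>set (fst (f n)). z < b n"
    and H_Suc: "H (Suc n) = returns x (N (fst (f n))) (H n) (b n)" for n
    using f[of n] by (auto simp: step_def H_def b_def split: prod.splits)
  have hist: "fst (f n) = map b [0..<n]" for n
    by (induction n) (simp_all add: f0 hist_Suc)
  have "strict_mono b"
    using bgt by (auto simp: strict_mono_Suc_iff hist)
  have H_anti: "H n \<subseteq> H m" if "m \<le> n" for m n
    using that
  proof (induction rule: dec_induct)
    case (step n)
    have "H (Suc n) \<subseteq> H n" unfolding H_Suc returns_def by force
    with step show ?case by blast
  qed simp
  have "b t * x ^ (M * b s) \<in> G" if st: "s < t" and M: "M \<le> N (map b [0..<s])" for s t M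
  proof -
    have "b t \<in> H (Suc s)" using bH H_anti[of "Suc s" t] st by auto
    then have "b t * x ^ (M * b s) \<in> H s" using M by (simp add: H_Suc returns_def hist)
    then show ?thesis using H_anti[of 0 s] by (auto simp: H_def f0)
  qed
  with \<open>strict_mono b\<close> show ?thesis by blast
qed

section \<open>Monochromatic exponential towers\<close>

lemma mult_closed_power:
  assumes "mult_closed X" "x \<in> X" "n > 0"
  shows "x ^ n \<in> X"
  using assms(3)
proof (induction n rule: nat_induct_non_zero)
  case (Suc n)
  then show ?case using assms(1,2) by (simp add: mult_closed_def)
qed (use assms(2) in simp)

theorem corollary2p11:
  fixes g :: "nat \<Rightarrow> nat" and r :: nat and C :: "nat \<Rightarrow> nat set" and X :: "nat set"
  assumes "g \<in> {1..} \<rightarrow> {1..}"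
    and "finite_coloring r C"
    and "X \<subseteq> {1..}" and "mult_closed X" and "X \<noteq> {}" and "X \<noteq> {1}"
  shows "\<exists>(a :: nat \<Rightarrow> nat) i. a \<in> {1..} \<rightarrow> {1..} \<and> strict_mono_on {1..} a \<and> i \<in> {1..r} \<and>
    (\<forall>k (n :: nat \<Rightarrow> nat) s t. k \<ge> 1 \<longrightarrow> (\<forall>j\<in>{1..k}. 1 \<le> n j \<and> n j < s) \<longrightarrow> s < t \<longrightarrow>
       k \<le> g (s - 1) \<longrightarrow>
       tower (a t # a s # map (\<lambda>j. a (n j)) [1..<k + 1]) \<in> X \<inter> C i)"
proof -
  from assms(5,6) obtain x where x: "x \<in> X" "x \<noteq> 1" by blast
  with assms(3) have x2: "x \<ge> 2" by force
  have "{1..} = (\<Union>i\<in>{1..r}. {e. e \<ge> 1 \<and> x ^ e \<in> C i})"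
  proof -
    have "x ^ e \<in> (\<Union>i\<in>{1..r}. C i)" for e
      using assms(2) x2 unfolding finite_coloring_def by simp
    then show ?thesis by auto
  qed
  with mult_PS_positives have "mult_PS (\<Union>i\<in>{1..r}. {e. e \<ge> 1 \<and> x ^ e \<in> C i})"
    by (simp only:)
  from mult_PS_UN[OF finite_atLeastAtMost this]
  obtain i where i: "i \<in> {1..r}" "mult_PS {e. e \<ge> 1 \<and> x ^ e \<in> C i}" by blast
  \<comment> \<open>All towers that may stand above \<open>a\<^sub>s\<close>, in terms of the exponents of the terms before \<open>a\<^sub>s\<close>.
    As the exponents are indexed from \<open>0\<close>, the length of \<open>h\<close> is the argument of \<open>g\<close>.\<close>
  define T where "T h = tower ` {l. set l \<subseteq> (\<lambda>e. x ^ e) ` set h \<and> length l \<le> g (length h)}"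
    for h :: "nat list"
  have finT: "finite (T h)" for h
    unfolding T_def by (intro finite_imageI finite_lists_length_le) simp
  have "x \<ge> 1" using x2 by simp
  from mult_PS_exponential_sequence[OF i(2) this, of "\<lambda>h. Max (T h)"]
  obtain b where b: "strict_mono b"
    and bG: "\<And>s t M. s < t \<Longrightarrow> M \<le> Max (T (map b [0..<s])) \<Longrightarrow>
       b t * x ^ (M * b s) \<in> {e. e \<ge> 1 \<and> x ^ e \<in> C i}"
    by blast
  define a where "a n = x ^ b (n - 1)" for n
  have "a \<in> {1..} \<rightarrow> {1..}" using x2 by (auto simp: a_def)
  moreover have "strict_mono_on {1..} a"
    using x2 b by (auto simp: strict_mono_on_def a_def strict_mono_less)
  moreover have "tower (a t # a s # map (\<lambda>j. a (n j)) [1..<k + 1]) \<in> X \<inter> C i"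
    if k: "k \<ge> 1" "k \<le> g (s - 1)" and n: "\<forall>j\<in>{1..k}. 1 \<le> n j \<and> n j < s" and st: "s < t"
    for k n s t
  proof -
    define l where "l = map (\<lambda>j. a (n j)) [1..<k + 1]"
    define e where "e = b (t - 1) * x ^ (tower l * b (s - 1))"
    have s: "s \<ge> 1" using n k(1) by force
    have "a (n j) \<in> (\<lambda>e. x ^ e) ` set (map b [0..<s - 1])" if "j \<in> {1..k}" for j
    proof -
      have "n j - 1 \<in> {0..<s - 1}" using n that by force
      then show ?thesis unfolding a_def by simp
    qed
    then have "set l \<subseteq> (\<lambda>e. x ^ e) ` set (map b [0..<s - 1])"
      by (auto simp: l_def less_Suc_eq_le simp del: upt_Suc)
    then have "tower l \<in> T (map b [0..<s - 1])"
      using k(2) unfolding T_def by (intro imageI) (simp add: l_def)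
    then have "tower l \<le> Max (T (map b [0..<s - 1]))" by (rule Max_ge[OF finT])
    with st s have e: "e \<ge> 1" "x ^ e \<in> C i"
      using bG[of "s - 1" "t - 1" "tower l"] by (auto simp: e_def)
    have "tower (a t # a s # l) = x ^ e"
      by (simp add: a_def e_def mult.commute flip: power_mult)
    moreover have "x ^ e \<in> X" using mult_closed_power[OF assms(4) x(1)] e(1) by simp
    ultimately show ?thesis using e(2) unfolding l_def by simp
  qed
  ultimately show ?thesis using i(1) by blast
qed

end
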